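(* Let $c>0$ and $\alpha$ be real constants such that $p=\dfrac{c}{N^{\alpha}}\in(0,1]$ for all sufficiently large $N$, and let $G_N$ be the random intersection graph, with edge set $\mathcal{E}_N$, of $N$ independent uniform spherical caps, each of area $4\pi p$, on the unit sphere. If $\alpha<1$, then almost surely, for all sufficiently large $N$, there are at least $N/2$ edges in $G_N$. If $\alpha>3$, then almost surely, for all sufficiently large $N$, there is no edge in $G_N$, i.e. $\mathcal{E}_N=\emptyset$.
   Context: Let $S^2$ be the unit sphere in $\mathbb{R}^3$, with total area $4\pi$. Let $X_1,X_2,\ldots$ be independent random points on a common probability space, each uniformly distributed on $S^2$. For a given $N$ and angular radius $a=a(N)$, let $C_i$ ($1\le i\le N$) be the (closed) spherical cap with center $X_i$ and angular radius $a$, i.e. the set of points of $S^2$ at geodesic distance at most $a$ from $X_i$. Let $p=p(a)=\sin^2(a/2)$ be the probability that a fixed point of the sphere is covered by a given cap; equivalently, each cap has area $4\pi p$. Prescribing $p\in(0,1]$ determines $a\in(0,\pi]$. The random intersection graph $G_N$ has vertex set $\mathcal{X}_N=\{X_1,\ldots,X_N\}$ and edge set $\mathcal{E}_N=\{X_iX_j: i\ne j,\ C_i\cap C_j\neq\emptyset\}$ (unordered pairs). "Almost surely, for all sufficiently large $N$" means: with probability one there is a (random) $N_0$ such that the property holds for all $N\ge N_0$. *)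

theory Defs
  imports "HOL-Probability.Probability"
begin

abbreviation S2 :: "(real^3) set"
  where "S2 \<equiv> sphere 0 1"

text \<open>
  Surface area on the unit sphere, obtained from integration in polar coordinates: the area of
  \<open>A \<subseteq> S2\<close> is \<open>3\<close> times the volume of the solid cone \<open>{r *\<^sub>R x | x \<in> A, 0 < r \<le> 1}\<close>, the factor
  being the reciprocal of the integral of \<open>r\<^sup>2\<close> over \<open>[0, 1]\<close>. Here \<open>sgn v = v /\<^sub>R norm v\<close>
  is the radial projection. The lemmas below show that this is a rotation-invariant measure of
  total mass \<open>4 * pi\<close>.
\<close>

definition sphere_area :: "(real^3) measure"
  where "sphere_area =
    distr (scale_measure 3 (restrict_space lborel (cball 0 1 - {0}))) (restrict_space borel S2) sgn"

definition uniform_sphere :: "(real^3) measure"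
  where "uniform_sphere = uniform_measure sphere_area S2"

text \<open>For unit vectors, the geodesic distance is the angle between them.\<close>

definition sphere_dist :: "real^3 \<Rightarrow> real^3 \<Rightarrow> real"
  where "sphere_dist x y = arccos (x \<bullet> y)"

definition spherical_cap :: "real^3 \<Rightarrow> real \<Rightarrow> (real^3) set"
  where "spherical_cap x a = {y \<in> S2. sphere_dist x y \<le> a}"

text \<open>
  The intersection graph of the caps of angular radius \<open>a\<close> centred at \<open>x 1, \<dots>, x N\<close>,
  as the pair of its vertex set and its edge set.
\<close>

definition cap_graph :: "(nat \<Rightarrow> real^3) \<Rightarrow> real \<Rightarrow> nat \<Rightarrow> (real^3) set \<times> (real^3) set set"
  where "cap_graph x a N =
    (x ` {1..N},
     {{x i, x j} | i j. i \<in> {1..N} \<and> j \<in> {1..N} \<and> i \<noteq> j \<and>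
        spherical_cap (x i) a \<inter> spherical_cap (x j) a \<noteq> {}})"

abbreviation verts :: "(real^3) set \<times> (real^3) set set \<Rightarrow> (real^3) set"
  where "verts G \<equiv> fst G"

abbreviation edges :: "(real^3) set \<times> (real^3) set set \<Rightarrow> (real^3) set set"
  where "edges G \<equiv> snd G"

lemma space_sphere_area [simp]: "space sphere_area = S2"
  by (simp add: sphere_area_def space_restrict_space)

lemma sets_sphere_area [measurable_cong]: "sets sphere_area = sets (restrict_space borel S2)"
  by (simp add: sphere_area_def)

lemma space_scale_sphere:
  "space (scale_measure r (restrict_space lborel (cball 0 1 - {0 :: real^3}))) = cball 0 1 - {0}"
  by (simp add: space_scale_measure space_restrict_space)

lemma measurable_sgn_sphere:
  "sgn \<in> scale_measure 3 (restrict_space lborel (cball 0 1 - {0})) \<rightarrow>\<^sub>M restrict_space borel S2"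
proof -
  have "sgn \<in> borel_measurable (restrict_space lborel (cball 0 1 - {0 :: real^3}))"
    unfolding sgn_div_norm[abs_def]
    by (intro measurable_restrict_space1) measurable
  then show ?thesis
    by (auto simp: measurable_restrict_space2_iff space_scale_sphere norm_sgn)
qed

lemma emeasure_sphere_area:
  assumes "A \<in> sets sphere_area"
  shows "emeasure sphere_area A = 3 * emeasure lborel {v \<in> cball 0 1 - {0}. sgn v \<in> A}"
proof -
  have A: "A \<in> sets (restrict_space borel S2)"
    using assms by (simp add: sets_sphere_area)
  have "sgn -` A \<inter> (cball 0 1 - {0}) = {v \<in> cball 0 1 - {0}. sgn v \<in> A}"
    by auto
  moreover have "emeasure (restrict_space lborel (cball 0 1 - {0})) {v \<in> cball 0 1 - {0}. sgn v \<in> A}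
      = emeasure lborel {v \<in> cball 0 1 - {0}. sgn v \<in> A}"
    by (rule emeasure_restrict_space) auto
  ultimately show ?thesis
    unfolding sphere_area_def
    by (subst emeasure_distr[OF measurable_sgn_sphere A])
       (simp only: space_scale_sphere emeasure_scale_measure)
qed

lemma sphere_area_total: "emeasure sphere_area S2 = ennreal (4 * pi)"
proof -
  have "S2 \<in> sets sphere_area"
    by (metis sets.top space_sphere_area)
  moreover have "{v \<in> cball 0 1 - {0 :: real^3}. sgn v \<in> S2} = cball 0 1 - {0}"
    by (auto simp: norm_sgn)
  moreover have "emeasure lborel (cball 0 1 - {0 :: real^3}) = ennreal (4 / 3 * pi)"
    by (simp add: emeasure_Diff emeasure_cball unit_ball_vol_3)
  ultimately show ?thesis
    by (simp add: emeasure_sphere_area flip: ennreal_numeral ennreal_mult')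
qed

lemma sphere_area_orthogonal_image:
  assumes f: "orthogonal_transformation f" and A: "A \<in> sets sphere_area"
  shows "emeasure sphere_area (f ` A) = emeasure sphere_area A"
proof -
  define K where "K A = {v \<in> cball 0 1 - {0 :: real^3}. sgn v \<in> A}" for A
  have K_sets: "K A \<in> sets lborel" if "A \<in> sets sphere_area" for A
  proof -
    have "sgn -` A \<inter> (cball 0 1 - {0}) \<in> sets (restrict_space lborel (cball 0 1 - {0 :: real^3}))"
      using measurable_sets[OF measurable_sgn_sphere, of A] that
      by (simp add: sets_sphere_area space_scale_sphere)
    moreover have "sgn -` A \<inter> (cball 0 1 - {0}) = K A"
      by (auto simp: K_def)
    ultimately show ?thesis
      by (simp add: sets_restrict_space_iff)
  qed
  have K_lm: "K A \<in> lmeasurable" if "A \<in> sets sphere_area" for A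
  proof (rule bounded_set_imp_lmeasurable)
    show "bounded (K A)"
      by (rule bounded_subset[OF bounded_cball[of 0 1]]) (auto simp: K_def)
    show "K A \<in> sets lebesgue"
      using K_sets[OF that] by simp
  qed
  have K_em: "emeasure lborel (K A) = ennreal (measure lebesgue (K A))"
    if "A \<in> sets sphere_area" for A
    using emeasure_eq_measure2[OF K_lm[OF that]] K_sets[OF that] by simp
  have nf: "norm (f v) = norm v" and lf: "linear f" for v
    using f by (auto simp: orthogonal_transformation)
  have inv: "orthogonal_transformation (inv f)" and bf: "bij f"
    using f orthogonal_transformation_inv orthogonal_transformation_bij by auto
  have fA: "f ` A \<in> sets sphere_area"
  proof -
    have A': "A \<in> sets borel" "A \<subseteq> S2"
      using A by (auto simp: sets_sphere_area sets_restrict_space_iff)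
    have "inv f \<in> borel_measurable borel"
      by (intro borel_measurable_continuous_onI linear_continuous_on)
         (use inv in \<open>simp add: orthogonal_transformation_linear linear_conv_bounded_linear[symmetric]\<close>)
    then have "inv f -` A \<in> sets borel"
      using A' measurable_sets_borel by blast
    moreover have "inv f -` A = f ` A"
      using bij_vimage_eq_inv_image[OF bij_imp_bij_inv[OF bf]] bf by (simp add: inv_inv_eq)
    ultimately show ?thesis
      using A' nf by (auto simp: sets_sphere_area sets_restrict_space_iff)
  qed
  have sgn_f: "sgn (f v) = f (sgn v)" for v
    by (simp add: sgn_div_norm nf linear_scale[OF lf])
  have "K (f ` A) = f ` K A"
  proof (intro equalityI subsetI)
    fix w assume w: "w \<in> K (f ` A)"
    obtain v where v: "w = f v" using bf by (metis bij_pointE)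
    have "sgn v \<in> A" 
      using w bf unfolding v K_def by (auto simp: sgn_f bij_def inj_image_mem_iff)
    then show "w \<in> f ` K A"
      using w nf unfolding v K_def by (auto simp: linear_0[OF lf])
  next
    fix w assume "w \<in> f ` K A"
    then show "w \<in> K (f ` A)"
      using nf by (auto simp: K_def sgn_f) (metis norm_eq_zero)
  qed
  then show ?thesis
    using emeasure_sphere_area[OF A] emeasure_sphere_area[OF fA] K_em[OF A] K_em[OF fA]
      measure_orthogonal_image[OF f K_lm[OF A]]
    by (simp add: K_def)
qed

end

theory Submission
  imports Defs
begin

text \<open>
  Both halves rest on the fact that a cap of chordal radius \<open>r\<close> occupies a share of the sphere
  comparable to \<open>r\<^sup>2\<close>. The conditions on \<open>\<alpha>\<close> are strict inequalities between powers of
  \<open>N\<close>, so constant factors do not matter, and the exact area of a cap is replaced by the two bounds \<open>r\<^sup>2 / 400\<close> and \<open>2 * r\<^sup>2\<close>, obtained by comparing the solid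
  cone over the cap with boxes. A cap of angular radius \<open>a\<close> has chordal radius
  \<open>2 * sin (a / 2) = 2 * sqrt p\<close>.

  For \<open>\<alpha> < 1\<close> the argument is deterministic once the points are distinct, which holds
  almost surely. Take a maximal set \<open>I\<close> of vertices with pairwise disjoint caps. The total area
  of these caps is at most that of the sphere, so \<open>I\<close> has \<open>O(1 / p)\<close> elements, and this is
  \<open>o(N)\<close>. By maximality every vertex outside \<open>I\<close> has a neighbour in \<open>I\<close>, and the edges
  chosen in this way are pairwise different; hence there are at least \<open>N - O(1 / p)\<close> edges
  (\<open>card_edges_ge\<close>).

  For \<open>\<alpha> > 3\<close>, an edge forces two of the points to be at distance at most \<open>4 * sqrt p\<close>,
  which for a given pair has probability \<open>O(p)\<close> (\<open>prob_close_le\<close>). The union bound over pairs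
  gives \<open>O(N\<^sup>2 * p) = O(N powr (2 - \<alpha>))\<close>, which is summable, and the first Borel--Cantelli
  lemma concludes (\<open>AE_eventually_far\<close>).
\<close>

section \<open>Caps and their areas\<close>

text \<open>
  The chord spanned by an angle \<open>a\<close> has length \<open>2 * sin (a / 2)\<close>. Describing caps by chords
  makes the triangle inequality of the ambient space available for them.
\<close>

lemma spherical_cap_eq_cball:
  assumes x: "x \<in> S2" and a: "0 \<le> a" "a \<le> pi"
  shows "spherical_cap x a = S2 \<inter> cball x (2 * sin (a / 2))"
proof -
  have "sphere_dist x y \<le> a \<longleftrightarrow> dist x y \<le> 2 * sin (a / 2)" if y: "y \<in> S2" for y
  proof -
    have n: "norm x = 1" "norm y = 1"
      using x y by auto
    have b: "\<bar>x \<bullet> y\<bar> \<le> 1"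
      using Cauchy_Schwarz_ineq2[of x y] n by simp
    have s: "0 \<le> sin (a / 2)"
      using a by (intro sin_ge_zero) auto
    have "arccos (x \<bullet> y) \<le> a \<longleftrightarrow> arccos (x \<bullet> y) \<le> arccos (cos a)"
      using a by (simp add: arccos_cos)
    also have "\<dots> \<longleftrightarrow> cos a \<le> x \<bullet> y"
      using b by (intro arccos_le_mono) auto
    also have "\<dots> \<longleftrightarrow> (dist x y)\<^sup>2 \<le> (2 * sin (a / 2))\<^sup>2"
    proof -
      have "cos a = 1 - 2 * (sin (a / 2))\<^sup>2"
        using cos_double_sin[of "a / 2"] by simp
      moreover have "x \<bullet> y = 1 - (dist x y)\<^sup>2 / 2"
        using n dot_norm_neg[of x y] by (simp add: dist_norm field_simps)
      ultimately show ?thesis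
        by (simp add: power_mult_distrib)
    qed
    also have "\<dots> \<longleftrightarrow> dist x y \<le> 2 * sin (a / 2)"
      using s by (intro power_mono_iff) auto
    finally show ?thesis
      by (simp add: sphere_dist_def)
  qed
  then show ?thesis
    by (auto simp: spherical_cap_def)
qed

lemma sets_uniform_sphere [measurable_cong]: "sets uniform_sphere = sets (restrict_space borel S2)"
  by (simp add: uniform_sphere_def sets_sphere_area)

lemma space_uniform_sphere [simp]: "space uniform_sphere = S2"
  by (simp add: uniform_sphere_def)

lemma prob_space_uniform_sphere: "prob_space uniform_sphere"
  unfolding uniform_sphere_def
  by (rule prob_space_uniform_measure) (auto simp: sphere_area_total)

lemma cball_in_sets_sphere: "S2 \<inter> cball x r \<in> sets sphere_area"
  by (auto simp: sets_sphere_area sets_restrict_space_iff)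

lemma sphere_area_cball_rotate:
  assumes "x \<in> S2" "y \<in> S2"
  shows "emeasure sphere_area (S2 \<inter> cball x r) = emeasure sphere_area (S2 \<inter> cball y r)"
proof -
  obtain f where f: "orthogonal_transformation f" "f x = y"
    using orthogonal_transformation_exists_1[of x y] assms by auto
  have "inj f"
    using f orthogonal_transformation_inj by blast
  moreover have "f ` S2 = S2"
    using image_orthogonal_transformation_cball[OF f(1), of 0 1]
      image_orthogonal_transformation_ball[OF f(1), of 0 1] \<open>inj f\<close>
      linear_0[OF orthogonal_transformation_linear[OF f(1)]]
    by (simp add: cball_diff_eq_sphere[symmetric] image_set_diff)
  ultimately have "f ` (S2 \<inter> cball x r) = S2 \<inter> cball y r"
    using image_orthogonal_transformation_cball[OF f(1), of x r] f(2) by (simp add: image_Int)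
  then show ?thesis
    using sphere_area_orthogonal_image[OF f(1) cball_in_sets_sphere, of x r] by simp
qed

lemma emeasure_lborel_cbox_3:
  fixes l u :: "real^3"
  assumes "\<forall>i. l $ i \<le> u $ i"
  shows "emeasure lborel (cbox l u) = ennreal ((u $ 1 - l $ 1) * (u $ 2 - l $ 2) * (u $ 3 - l $ 3))"
proof -
  have "cbox l u \<noteq> {}"
    using assms by (auto simp: interval_ne_empty_cart)
  then have "measure lborel (cbox l u) = (\<Prod>i\<in>UNIV. u $ i - l $ i)"
    by (rule content_cbox_cart)
  also have "\<dots> = (u $ 1 - l $ 1) * (u $ 2 - l $ 2) * (u $ 3 - l $ 3)"
    unfolding UNIV_3 by simp
  finally have "measure lborel (cbox l u) = (u $ 1 - l $ 1) * (u $ 2 - l $ 2) * (u $ 3 - l $ 3)" .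
  moreover have "emeasure lborel (cbox l u) = ennreal (measure lborel (cbox l u))"
    by (rule emeasure_eq_ennreal_measure) (rule less_imp_neq[OF emeasure_lborel_cbox_finite, simplified])
  ultimately show ?thesis
    by (simp only:)
qed

lemma uniform_sphere_eq_area:
  assumes "A \<in> sets sphere_area"
  shows "measure uniform_sphere A = measure sphere_area A / (4 * pi)"
proof -
  have "S2 \<inter> A = A"
    using sets.sets_into_space[OF assms] by auto
  then show ?thesis
    unfolding uniform_sphere_def
    using assms sets.top[of sphere_area]
    by (subst measure_uniform_measure) (auto simp: sphere_area_total measure_def)
qed

text \<open>
  After rotating the centre to the north pole, every point of the solid cone over the cap has its
  horizontal coordinates bounded by \<open>r\<close>, so the cone lies in a box of volume \<open>8 * r\<^sup>2\<close>.
\<close>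

lemma sphere_area_cball_le:
  assumes x: "x \<in> S2" and r: "0 \<le> r"
  shows "emeasure sphere_area (S2 \<inter> cball x r) \<le> ennreal (24 * r\<^sup>2)"
proof -
  define e :: "real^3" where "e = axis 3 1"
  have e: "e \<in> S2"
    by (simp add: e_def)
  have e_nth: "e $ 1 = 0" "e $ 2 = 0"
    by (auto simp: e_def axis_def)
  define u :: "real^3" where "u = vector [r, r, 1]"
  have u: "u $ 1 = r" "u $ 2 = r" "u $ 3 = 1"
    by (auto simp: u_def vector_3)
  have "{v \<in> cball 0 1 - {0}. sgn v \<in> S2 \<inter> cball e r} \<subseteq> cbox (- u) u"
  proof
    fix v assume "v \<in> {v \<in> cball 0 1 - {0}. sgn v \<in> S2 \<inter> cball e r}"
    then have n: "norm v \<le> 1" and v: "v \<noteq> 0" "sgn v \<in> cball e r"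
      by auto
    have d: "\<bar>v $ i\<bar> \<le> r" if "e $ i = 0" for i
    proof -
      have "\<bar>sgn v $ i\<bar> \<le> r"
        using component_le_norm_cart[of "e - sgn v" i] that v by (simp add: dist_norm)
      then have "\<bar>v $ i\<bar> \<le> norm v * r"
        using v by (simp add: sgn_div_norm abs_mult field_simps)
      also have "\<dots> \<le> r"
        using n r mult_right_mono[of "norm v" 1 r] by simp
      finally show ?thesis .
    qed
    have "\<bar>v $ 3\<bar> \<le> 1"
      using component_le_norm_cart[of v 3] n by simp
    then show "v \<in> cbox (- u) u"
      using d[of 1] d[of 2] e_nth u by (auto simp: mem_box_cart forall_3 abs_le_iff)
  qed
  then have "emeasure lborel {v \<in> cball 0 1 - {0}. sgn v \<in> S2 \<inter> cball e r} \<le> emeasure lborel (cbox (- u) u)"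
    by (intro emeasure_mono) auto
  also have "\<dots> = ennreal (8 * r\<^sup>2)"
    using r u by (subst emeasure_lborel_cbox_3) (auto simp: forall_3 power2_eq_square)
  finally have "emeasure sphere_area (S2 \<inter> cball e r) \<le> 3 * ennreal (8 * r\<^sup>2)"
    by (simp add: emeasure_sphere_area[OF cball_in_sets_sphere] mult_left_mono)
  also have "\<dots> = ennreal (24 * r\<^sup>2)"
    by (simp flip: ennreal_numeral ennreal_mult')
  finally show ?thesis
    by (simp add: sphere_area_cball_rotate[OF x e])
qed

text \<open>
  Conversely, the cone contains a box of volume \<open>r\<^sup>2 / 64\<close>: at height between \<open>1 / 4\<close> and
  \<open>1 / 2\<close>, horizontal coordinates of size at most \<open>r / 8\<close> tilt a vector away from the pole by
  so little that its direction stays within distance \<open>r\<close> of the pole.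
\<close>

lemma sphere_area_cball_ge:
  assumes x: "x \<in> S2" and r: "0 \<le> r" "r \<le> 2"
  shows "ennreal (3 * r\<^sup>2 / 64) \<le> emeasure sphere_area (S2 \<inter> cball x r)"
proof -
  define e :: "real^3" where "e = axis 3 1"
  have e: "e \<in> S2"
    by (simp add: e_def)
  have e_nth: "e $ 1 = 0" "e $ 2 = 0"
    by (auto simp: e_def axis_def)
  define l :: "real^3" where "l = vector [- r / 8, - r / 8, 1 / 4]"
  define u :: "real^3" where "u = vector [r / 8, r / 8, 1 / 2]"
  have lu: "l $ 1 = - r / 8" "l $ 2 = - r / 8" "l $ 3 = 1 / 4" "u $ 1 = r / 8" "u $ 2 = r / 8" "u $ 3 = 1 / 2"
    by (auto simp: l_def u_def vector_3)
  let ?K = "{v \<in> cball 0 1 - {0}. sgn v \<in> S2 \<inter> cball e r}"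
  have "cbox l u \<subseteq> ?K"
  proof
    fix v assume "v \<in> cbox l u"
    then have v: "\<bar>v $ 1\<bar> \<le> r / 8" "\<bar>v $ 2\<bar> \<le> r / 8" "1 / 4 \<le> v $ 3" "v $ 3 \<le> 1 / 2"
      using lu by (auto simp: mem_box_cart forall_3 abs_le_iff)
    have v2: "(v $ 1)\<^sup>2 \<le> r\<^sup>2 / 64" "(v $ 2)\<^sup>2 \<le> r\<^sup>2 / 64" "1 / 16 \<le> (v $ 3)\<^sup>2" "(v $ 3)\<^sup>2 \<le> 1 / 4" "r\<^sup>2 \<le> 4"
      using power_mono[OF v(1), of 2] power_mono[OF v(2), of 2] power_mono[OF v(3), of 2]
        power_mono[OF v(4), of 2] power_mono[OF r(2), of 2] v r
      by (auto simp: power2_eq_square)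
    have n: "(norm v)\<^sup>2 = (v $ 1)\<^sup>2 + (v $ 2)\<^sup>2 + (v $ 3)\<^sup>2"
      unfolding power2_norm_eq_inner by (simp add: inner_vec_def sum_3 power2_eq_square)
    have "(norm v)\<^sup>2 \<le> 1"
      using v2 unfolding n by linarith
    then have n1: "norm v \<le> 1"
      by (simp add: power_le_one_iff)
    have "v \<noteq> 0"
      using v by auto
    \<comment> \<open>A unit vector lies within \<open>r\<close> of the pole iff its inner product with the pole is at
      least \<open>1 - t\<close>.\<close>
    define t where "t = r\<^sup>2 / 2"
    have t: "(1 - t) * norm v \<le> v $ 3"
    proof (cases "t \<le> 1")
      case True
      have "(norm v)\<^sup>2 \<le> (1 + t) * (v $ 3)\<^sup>2"
      proof -
        have "t * (1 / 16) \<le> t * (v $ 3)\<^sup>2"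
          using v2 by (intro mult_left_mono) (auto simp: t_def)
        then show ?thesis
          using v2 unfolding n t_def by (simp add: algebra_simps)
      qed
      then have "(1 - t)\<^sup>2 * (norm v)\<^sup>2 \<le> (1 - t)\<^sup>2 * ((1 + t) * (v $ 3)\<^sup>2)"
        by (intro mult_left_mono) auto
      also have "\<dots> = ((1 - t) * (1 - t\<^sup>2)) * (v $ 3)\<^sup>2"
        by (simp add: power2_eq_square algebra_simps)
      also have "\<dots> \<le> 1 * (v $ 3)\<^sup>2"
        using True by (intro mult_right_mono mult_le_one) (auto simp: t_def power_le_one)
      finally have "((1 - t) * norm v)\<^sup>2 \<le> (v $ 3)\<^sup>2"
        by (simp add: power_mult_distrib)
      then show ?thesis
        using v by (auto intro: power2_le_imp_le[where x = "(1 - t) * norm v"])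
    next
      case False
      then have "(1 - t) * norm v \<le> 0"
        by (intro mult_nonpos_nonneg) auto
      then show ?thesis
        using v by linarith
    qed
    have "e \<bullet> sgn v = v $ 3 / norm v"
      by (simp add: e_def inner_axis' sgn_div_norm field_simps)
    moreover have "1 - t \<le> v $ 3 / norm v"
      using t \<open>v \<noteq> 0\<close> by (simp add: pos_le_divide_eq)
    moreover have "e \<bullet> sgn v = 1 - (dist e (sgn v))\<^sup>2 / 2"
      using e \<open>v \<noteq> 0\<close> dot_norm_neg[of e "sgn v"] by (simp add: dist_norm norm_sgn field_simps)
    ultimately have "(dist e (sgn v))\<^sup>2 \<le> r\<^sup>2"
      by (simp add: t_def)
    then have "dist e (sgn v) \<le> r"
      using r by (simp add: power2_le_iff_abs_le)
    then show "v \<in> ?K"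
      using n1 \<open>v \<noteq> 0\<close> by (auto simp: norm_sgn)
  qed
  moreover have "?K \<in> sets lborel"
  proof -
    have "sgn \<in> borel_measurable (borel :: (real^3) measure)"
      unfolding sgn_div_norm[abs_def] by measurable
    then have "sgn -` (S2 \<inter> cball e r) \<in> sets borel"
      using measurable_sets[of sgn borel borel "S2 \<inter> cball e r"] by simp
    then have "sgn -` (S2 \<inter> cball e r) \<inter> (cball 0 1 - {0}) \<in> sets borel"
      by auto
    moreover have "sgn -` (S2 \<inter> cball e r) \<inter> (cball 0 1 - {0}) = ?K"
      by auto
    ultimately show ?thesis
      by simp
  qed
  ultimately have "emeasure lborel (cbox l u) \<le> emeasure lborel ?K"
    by (intro emeasure_mono) auto
  moreover have "emeasure lborel (cbox l u) = ennreal (r\<^sup>2 / 64)"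
    using r lu by (subst emeasure_lborel_cbox_3) (auto simp: forall_3 power2_eq_square)
  ultimately have "3 * ennreal (r\<^sup>2 / 64) \<le> emeasure sphere_area (S2 \<inter> cball e r)"
    by (simp add: emeasure_sphere_area[OF cball_in_sets_sphere] mult_left_mono)
  moreover have "3 * ennreal (r\<^sup>2 / 64) = ennreal (3 * r\<^sup>2 / 64)"
    by (simp flip: ennreal_numeral ennreal_mult')
  ultimately show ?thesis
    by (simp add: sphere_area_cball_rotate[OF x e])
qed

lemma measure_uniform_cball_le:
  assumes "x \<in> S2" "0 \<le> r"
  shows "measure uniform_sphere (S2 \<inter> cball x r) \<le> 2 * r\<^sup>2"
proof -
  have "measure sphere_area (S2 \<inter> cball x r) \<le> 24 * r\<^sup>2"
    unfolding measure_def using sphere_area_cball_le[OF assms] by (intro enn2real_leI) auto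
  also have "\<dots> \<le> 2 * r\<^sup>2 * (4 * pi)"
    using pi_gt3 mult_right_mono[of 3 pi "8 * r\<^sup>2"] by (simp add: algebra_simps)
  finally show ?thesis
    by (simp add: uniform_sphere_eq_area[OF cball_in_sets_sphere] pos_divide_le_eq)
qed

lemma measure_uniform_cball_ge:
  assumes "x \<in> S2" "0 \<le> r" "r \<le> 2"
  shows "r\<^sup>2 / 400 \<le> measure uniform_sphere (S2 \<inter> cball x r)"
proof -
  have fin: "emeasure sphere_area (S2 \<inter> cball x r) \<noteq> \<top>"
    using sphere_area_cball_le[OF assms(1,2)] by (auto simp: top_unique)
  have "pi * r\<^sup>2 \<le> 4 * r\<^sup>2"
    using pi_less_4 by (intro mult_right_mono) auto
  moreover have "r\<^sup>2 / 400 * (4 * pi) = pi * r\<^sup>2 / 100"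
    by simp
  ultimately have "r\<^sup>2 / 400 * (4 * pi) \<le> 3 * r\<^sup>2 / 64"
    using zero_le_power2[of r] by linarith
  also have "\<dots> \<le> measure sphere_area (S2 \<inter> cball x r)"
    using sphere_area_cball_ge[OF assms] fin by (simp add: emeasure_eq_ennreal_measure)
  finally show ?thesis
    unfolding uniform_sphere_eq_area[OF cball_in_sets_sphere] by (subst pos_le_divide_eq) auto
qed

section \<open>A lower bound for the number of edges\<close>

text \<open>
  Greedy choice: a new element joins the independent set unless it is related to a member.
\<close>

lemma exists_maximal_independent:
  assumes "finite V" and "symp R"
  shows "\<exists>I \<subseteq> V. (\<forall>u\<in>I. \<forall>v\<in>I. u \<noteq> v \<longrightarrow> \<not> R u v) \<and> (\<forall>v\<in>V - I. \<exists>u\<in>I. R u v)"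
  using assms(1)
proof (induction V)
  case (insert w V)
  then obtain I where I: "I \<subseteq> V" "\<forall>u\<in>I. \<forall>v\<in>I. u \<noteq> v \<longrightarrow> \<not> R u v" "\<forall>v\<in>V - I. \<exists>u\<in>I. R u v"
    by auto
  show ?case
  proof (cases "\<exists>u\<in>I. R u w")
    case True
    then show ?thesis
      using I by (intro exI[of _ I]) auto
  next
    case False
    then have "\<forall>u\<in>I. \<not> R w u"
      using sympD[OF assms(2)] by blast
    then show ?thesis
      using I False by (intro exI[of _ "insert w I"]) auto
  qed
qed auto

text \<open>
  Packing bounds the independent set of the caps: disjoint caps of share at least
  \<open>(sin (a / 2))\<^sup>2 / 100\<close> fit on the sphere at most \<open>100 / (sin (a / 2))\<^sup>2\<close> times. Every vertex
  \<open>v\<close> outside a maximal independent set \<open>I\<close> contributes an edge \<open>{g v, v}\<close> with \<open>g v\<close> in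
  \<open>I\<close>, and this edge determines \<open>v\<close> as its endpoint not in \<open>I\<close>. Distinctness of the points
  matters because edges are sets of points: coinciding points would merge edges.
\<close>

lemma card_edges_ge:
  assumes x: "inj_on x {1..N}" "x ` {1..N} \<subseteq> S2" and a: "0 < a" "a \<le> pi"
  shows "real N \<le> real (card (edges (cap_graph x a N))) + 100 / (sin (a / 2))\<^sup>2"
proof -
  let ?C = "\<lambda>v. spherical_cap v a"
  let ?E = "edges (cap_graph x a N)"
  define V where "V = x ` {1..N}"
  have V: "finite V" "card V = N" "V \<subseteq> S2"
    using x by (auto simp: V_def card_image)
  have "symp (\<lambda>u v. ?C u \<inter> ?C v \<noteq> {})"
    by (auto simp: symp_def)
  then obtain I where I: "I \<subseteq> V" "\<And>u v. u \<in> I \<Longrightarrow> v \<in> I \<Longrightarrow> u \<noteq> v \<Longrightarrow> ?C u \<inter> ?C v = {}"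
    "\<forall>v\<in>V - I. \<exists>u\<in>I. ?C u \<inter> ?C v \<noteq> {}"
    using exists_maximal_independent[OF V(1), of "\<lambda>u v. ?C u \<inter> ?C v \<noteq> {}"] by auto
  have "finite I"
    using I(1) V(1) finite_subset by blast
  obtain g where g: "\<And>v. v \<in> V - I \<Longrightarrow> g v \<in> I \<and> ?C (g v) \<inter> ?C v \<noteq> {}"
    using I(3) by metis
  have "card (V - I) \<le> card ?E"
  proof (rule card_inj_on_le)
    show "inj_on (\<lambda>v. {g v, v}) (V - I)"
      using g by (auto simp: inj_on_def doubleton_eq_iff)
    show "(\<lambda>v. {g v, v}) ` (V - I) \<subseteq> ?E"
    proof safe
      fix v assume v: "v \<in> V" "v \<notin> I"
      have "g v \<in> V"
        using g[of v] v I(1) by auto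
      then obtain i j where ij: "g v = x i" "v = x j" "i \<in> {1..N}" "j \<in> {1..N}"
        using v(1) unfolding V_def by blast
      moreover have "i \<noteq> j"
        using g[of v] v ij by auto
      ultimately show "{g v, v} \<in> ?E"
        using g[of v] v by (auto simp: cap_graph_def)
    qed
    have "?E \<subseteq> Pow V"
      by (auto simp: cap_graph_def V_def)
    then show "finite ?E"
      using V(1) finite_subset by blast
  qed
  moreover have "real (card I) \<le> 100 / (sin (a / 2))\<^sup>2"
  proof -
    interpret U: prob_space uniform_sphere
      by (rule prob_space_uniform_sphere)
    define r where "r = 2 * sin (a / 2)"
    have s: "0 < sin (a / 2)"
      using a by (intro sin_gt_zero) auto
    have r: "0 \<le> r" "r \<le> 2"
      using s by (auto simp: r_def)
    have C: "?C v = S2 \<inter> cball v r" if "v \<in> I" for v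
      using spherical_cap_eq_cball[of v a] that I(1) V(3) a by (auto simp: r_def)
    have "real (card I) * (r\<^sup>2 / 400) \<le> (\<Sum>v\<in>I. measure uniform_sphere (?C v))"
      using measure_uniform_cball_ge[OF _ r] I(1) V(3) C by (intro sum_bounded_below) auto
    also have "\<dots> = measure uniform_sphere (\<Union>v\<in>I. ?C v)"
    proof (rule U.finite_measure_finite_Union[symmetric])
      show "?C ` I \<subseteq> sets uniform_sphere"
        using C cball_in_sets_sphere by (auto simp: uniform_sphere_def)
      show "disjoint_family_on ?C I"
        using I(2) by (auto simp: disjoint_family_on_def)
    qed fact
    also have "\<dots> \<le> 1"
      by simp
    finally show ?thesis
      using s by (simp add: r_def power_mult_distrib field_simps)
  qed
  moreover have "N \<le> card (V - I) + card I"
    using V I(1) \<open>finite I\<close> card_mono[OF V(1) I(1)] by (simp add: card_Diff_subset)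
  ultimately show ?thesis
    by linarith
qed

section \<open>Absence of edges\<close>

lemma edges_empty:
  assumes x: "x ` {1..N} \<subseteq> S2" and a: "0 \<le> a" "a \<le> pi"
    and far: "\<And>i j. i \<in> {1..N} \<Longrightarrow> j \<in> {1..N} \<Longrightarrow> i \<noteq> j \<Longrightarrow> dist (x i) (x j) > 4 * sin (a / 2)"
  shows "edges (cap_graph x a N) = {}"
proof -
  have "spherical_cap (x i) a \<inter> spherical_cap (x j) a = {}"
    if ij: "i \<in> {1..N}" "j \<in> {1..N}" "i \<noteq> j" for i j
  proof -
    have "False" if "y \<in> cball (x i) (2 * sin (a / 2))" "y \<in> cball (x j) (2 * sin (a / 2))" for y
      using far[OF ij] that dist_triangle2[of "x i" "x j" y] by (simp add: dist_commute)
    then show ?thesis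
      using spherical_cap_eq_cball[OF _ a] x ij by blast
  qed
  then show ?thesis
    by (auto simp: cap_graph_def)
qed

section \<open>Independent uniform points\<close>

locale uniform_points = prob_space M for M :: "'a measure" +
  fixes X :: "nat \<Rightarrow> 'a \<Rightarrow> real^3"
  assumes indep: "indep_vars (\<lambda>_. uniform_sphere) X {1..}"
    and uniform: "\<And>i. i \<ge> 1 \<Longrightarrow> distr M uniform_sphere (X i) = uniform_sphere"
begin

lemma X_measurable: "i \<ge> 1 \<Longrightarrow> X i \<in> M \<rightarrow>\<^sub>M uniform_sphere"
  using indep by (auto simp: indep_vars_def)

lemma X_borel: "i \<ge> 1 \<Longrightarrow> X i \<in> borel_measurable M"
  using X_measurable[of i] measurable_cong_sets[OF refl sets_uniform_sphere, of M]
  by (auto simp: measurable_restrict_space2_iff)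

lemma X_sphere: "i \<ge> 1 \<Longrightarrow> \<omega> \<in> space M \<Longrightarrow> X i \<omega> \<in> S2"
  using X_measurable[of i] by (metis measurable_space space_uniform_sphere)

lemma close_event:
  assumes "i \<ge> 1" "j \<ge> 1"
  shows "{\<omega> \<in> space M. dist (X i \<omega>) (X j \<omega>) \<le> r} \<in> events"
  using X_borel[OF assms(1)] X_borel[OF assms(2)] by measurable

text \<open>
  By independence and Fubini, one of the two points may be held fixed, and the other one then has
  to fall into a cap around it.
\<close>

lemma prob_close_le:
  assumes ij: "i \<ge> 1" "j \<ge> 1" "i \<noteq> j" and r: "0 \<le> r"
  shows "prob {\<omega> \<in> space M. dist (X i \<omega>) (X j \<omega>) \<le> r} \<le> 2 * r\<^sup>2"
proof -
  interpret U: prob_space uniform_sphere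
    by (rule prob_space_uniform_sphere)
  let ?U = "uniform_sphere \<Otimes>\<^sub>M uniform_sphere"
  have "indep_var uniform_sphere (X i) uniform_sphere (X j)"
  proof -
    have "indep_var uniform_sphere ((\<lambda>f. f i) \<circ> (\<lambda>\<omega>. restrict (\<lambda>k. X k \<omega>) {i}))
      uniform_sphere ((\<lambda>f. f j) \<circ> (\<lambda>\<omega>. restrict (\<lambda>k. X k \<omega>) {j}))"
      using ij by (intro indep_var_compose[OF indep_var_restrict[OF indep]]) auto
    then show ?thesis
      by (simp add: comp_def)
  qed
  then have D: "distr M ?U (\<lambda>\<omega>. (X i \<omega>, X j \<omega>)) = ?U"
    using indep_var_distribution_eq[of uniform_sphere "X i" uniform_sphere "X j"] uniform ij by simp
  let ?B = "{z \<in> space ?U. dist (fst z) (snd z) \<le> r}"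
  have "(\<lambda>x. x) \<in> uniform_sphere \<rightarrow>\<^sub>M borel"
    unfolding measurable_cong_sets[OF sets_uniform_sphere refl]
    by (rule measurable_restrict_space1) simp
  then have m: "fst \<in> borel_measurable ?U" "snd \<in> borel_measurable ?U"
    using measurable_compose[OF measurable_fst] measurable_compose[OF measurable_snd] by auto
  have B: "?B \<in> sets ?U"
    using m by measurable
  have XX: "(\<lambda>\<omega>. (X i \<omega>, X j \<omega>)) \<in> M \<rightarrow>\<^sub>M ?U"
    using X_measurable ij by (intro measurable_Pair) auto
  have "{\<omega> \<in> space M. dist (X i \<omega>) (X j \<omega>) \<le> r} = (\<lambda>\<omega>. (X i \<omega>, X j \<omega>)) -` ?B \<inter> space M"
    using measurable_space[OF XX] by auto
  then have "emeasure M {\<omega> \<in> space M. dist (X i \<omega>) (X j \<omega>) \<le> r} = emeasure ?U ?B"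
    using emeasure_distr[OF XX B] by (simp add: D)
  also have "\<dots> = (\<integral>\<^sup>+ x. emeasure uniform_sphere (Pair x -` ?B) \<partial>uniform_sphere)"
    by (rule U.emeasure_pair_measure_alt[OF B])
  also have "\<dots> \<le> (\<integral>\<^sup>+ x. ennreal (2 * r\<^sup>2) \<partial>uniform_sphere)"
  proof (rule nn_integral_mono)
    fix x assume "x \<in> space uniform_sphere"
    then have x: "x \<in> S2"
      by simp
    have "Pair x -` ?B = S2 \<inter> cball x r"
      using x by (auto simp: space_pair_measure)
    then show "emeasure uniform_sphere (Pair x -` ?B) \<le> ennreal (2 * r\<^sup>2)"
      using measure_uniform_cball_le[OF x r] by (simp add: U.emeasure_eq_measure)
  qed
  also have "\<dots> = ennreal (2 * r\<^sup>2)"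
    by (simp add: U.emeasure_space_1[simplified])
  finally show ?thesis
    by (simp add: emeasure_eq_measure)
qed

text \<open>Coincidence of two points is the case of radius zero of the preceding bound.\<close>

lemma AE_inj: "AE \<omega> in M. inj_on (\<lambda>i. X i \<omega>) {1..}"
proof -
  have "AE \<omega> in M. X i \<omega> \<noteq> X j \<omega>" if ij: "i \<ge> 1" "j \<ge> 1" "i \<noteq> j" for i j
  proof -
    have "prob {\<omega> \<in> space M. dist (X i \<omega>) (X j \<omega>) \<le> 0} = 0"
      using prob_close_le[OF ij, of 0] by (simp add: measure_le_0_iff)
    then show ?thesis
      using close_event[OF ij(1,2), of 0]
      by (subst AE_iff_measurable[OF _ refl]) (auto simp: emeasure_eq_measure)
  qed
  then have "AE \<omega> in M. \<forall>i. \<forall>j. i \<ge> 1 \<and> j \<ge> 1 \<and> i \<noteq> j \<longrightarrow> X i \<omega> \<noteq> X j \<omega>"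
    by (simp add: AE_all_countable)
  then show ?thesis
    by eventually_elim (auto simp: inj_on_def)
qed

text \<open>
  Union bound over the at most \<open>N\<^sup>2\<close> ordered pairs, followed by the Borel--Cantelli lemma.
\<close>

lemma AE_eventually_far:
  assumes r: "\<And>N. 0 \<le> r N" and sum: "summable (\<lambda>N. (real N * r N)\<^sup>2)"
  shows "AE \<omega> in M. \<forall>\<^sub>F N in sequentially.
    \<forall>i\<in>{1..N}. \<forall>j\<in>{1..N}. i \<noteq> j \<longrightarrow> dist (X i \<omega>) (X j \<omega>) > r N"
proof -
  define P where "P N = {(i, j). i \<in> {1..N} \<and> j \<in> {1..N} \<and> i \<noteq> j}" for N :: nat
  define B where "B N = (\<Union>(i, j)\<in>P N. {\<omega> \<in> space M. dist (X i \<omega>) (X j \<omega>) \<le> r N})" for N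
  have P_sub: "P N \<subseteq> {1..N} \<times> {1..N}" for N
    by (auto simp: P_def)
  have P_fin: "finite (P N)" for N
    by (rule finite_subset[OF P_sub]) simp
  have P_card: "card (P N) \<le> N\<^sup>2" for N
    using card_mono[OF _ P_sub, of N] by (simp add: card_cartesian_product power2_eq_square)
  have B_ev: "B N \<in> events" for N
    unfolding B_def using P_fin by (intro sets.finite_UN) (auto simp: P_def intro!: close_event)
  have B_le: "prob (B N) \<le> 2 * (real N * r N)\<^sup>2" for N
  proof -
    have "prob (B N) \<le> (\<Sum>z\<in>P N. prob (case z of (i, j) \<Rightarrow> {\<omega> \<in> space M. dist (X i \<omega>) (X j \<omega>) \<le> r N}))"
      unfolding B_def using P_fin
      by (intro finite_measure_subadditive_finite) (auto simp: P_def intro!: close_event)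
    also have "\<dots> \<le> real (card (P N)) * (2 * (r N)\<^sup>2)"
      using prob_close_le r by (intro sum_bounded_above) (auto simp: P_def)
    also have "\<dots> \<le> real (N\<^sup>2) * (2 * (r N)\<^sup>2)"
      using P_card[of N] by (intro mult_right_mono) (auto simp del: of_nat_power)
    finally show ?thesis
      by (simp add: power_mult_distrib)
  qed
  have "summable (\<lambda>N. prob (B N))"
    by (rule summable_comparison_test'[OF summable_mult[OF sum, of 2], of 0]) (use B_le in auto)
  then have "AE \<omega> in M. \<forall>\<^sub>F N in sequentially. \<omega> \<in> space M - B N"
    by (intro borel_cantelli_AE1 B_ev) (auto simp: emeasure_eq_measure)
  then show ?thesis
  proof eventually_elim
    case (elim \<omega>)
    then show ?case
    proof eventually_elim
      case (elim N)
      have "r N < dist (X i \<omega>) (X j \<omega>)" if "i \<in> {1..N}" "j \<in> {1..N}" "i \<noteq> j" for i j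
      proof -
        have "(i, j) \<in> P N"
          using that by (simp add: P_def)
        then show ?thesis
          using elim unfolding B_def by force
      qed
      then show ?case
        by blast
    qed
  qed
qed

end

theorem theorem4p2:
  fixes M :: "'a measure"
    and X :: "nat \<Rightarrow> 'a \<Rightarrow> real^3"
    and c \<alpha> :: real
    and p a :: "nat \<Rightarrow> real"
  assumes "prob_space M"
    and "prob_space.indep_vars M (\<lambda>_. uniform_sphere) X {1..}"
    and "\<And>i. i \<ge> 1 \<Longrightarrow> distr M uniform_sphere (X i) = uniform_sphere"
    and "c > 0"
    and "\<And>N. p N = c / real N powr \<alpha>"
    and "\<forall>\<^sub>F N in sequentially. p N \<in> {0<..1}"
    and "\<forall>\<^sub>F N in sequentially. a N \<in> {0<..pi} \<and> p N = (sin (a N / 2))\<^sup>2"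
  shows "(\<alpha> < 1 \<longrightarrow>
           (AE \<omega> in M. \<forall>\<^sub>F N in sequentially.
              real (card (edges (cap_graph (\<lambda>i. X i \<omega>) (a N) N))) \<ge> real N / 2)) \<and>
         (\<alpha> > 3 \<longrightarrow>
           (AE \<omega> in M. \<forall>\<^sub>F N in sequentially.
              edges (cap_graph (\<lambda>i. X i \<omega>) (a N) N) = {}))"
proof (intro conjI impI)
  interpret prob_space M by fact
  interpret uniform_points M X
    by unfold_locales (use assms in auto)
  assume \<alpha>: "\<alpha> < 1"
  \<comment> \<open>The size bound \<open>100 / p N\<close> of an independent set is a constant times \<open>N powr \<alpha>\<close>,
    which is of smaller order than \<open>N\<close>.\<close>
  have "(\<lambda>N. real N powr (\<alpha> - 1)) \<longlonglongrightarrow> 0"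
    using \<alpha> by (intro tendsto_neg_powr filterlim_real_sequentially) auto
  then have "\<forall>\<^sub>F N in sequentially. real N powr (\<alpha> - 1) < c / 200"
    using assms(4) by (intro order_tendstoD(2)) auto
  then have small: "\<forall>\<^sub>F N in sequentially. 100 / p N \<le> real N / 2"
    using eventually_gt_at_top[of 0]
  proof eventually_elim
    case (elim N)
    then have "100 / p N = 100 / c * (real N powr (\<alpha> - 1) * real N)"
      by (simp add: assms(5) powr_diff)
    also have "\<dots> \<le> 100 / c * (c / 200 * real N)"
      using elim assms(4) by (intro mult_left_mono mult_right_mono) auto
    finally show ?case
      using assms(4) by simp
  qed
  show "AE \<omega> in M. \<forall>\<^sub>F N in sequentially.
      real (card (edges (cap_graph (\<lambda>i. X i \<omega>) (a N) N))) \<ge> real N / 2"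
    using AE_inj AE_space
  proof eventually_elim
    case (elim \<omega>)
    show ?case
      using small assms(7)
    proof eventually_elim
      case (elim N)
      have "inj_on (\<lambda>i. X i \<omega>) {1..N}"
        using \<open>inj_on (\<lambda>i. X i \<omega>) {1..}\<close> by (rule inj_on_subset) auto
      moreover have "(\<lambda>i. X i \<omega>) ` {1..N} \<subseteq> S2"
        using X_sphere \<open>\<omega> \<in> space M\<close> by (intro image_subsetI) simp
      ultimately have "real N \<le> real (card (edges (cap_graph (\<lambda>i. X i \<omega>) (a N) N))) + 100 / p N"
        using card_edges_ge[of "\<lambda>i. X i \<omega>" N "a N"] elim by simp
      then show ?case
        using elim by linarith
    qed
  qed
next
  interpret prob_space M by fact
  interpret uniform_points M X
    by unfold_locales (use assms in auto)
  assume \<alpha>: "\<alpha> > 3"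
  \<comment> \<open>Twice the chordal radius \<open>2 * sqrt (p N)\<close> of the caps.\<close>
  define r where "r N = 4 * sqrt (p N)" for N
  have "(real N * r N)\<^sup>2 = 16 * c * real N powr (2 - \<alpha>)" if "N > 0" for N
  proof -
    have "(real N * r N)\<^sup>2 = 16 * c * (real N ^ 2 / real N powr \<alpha>)"
      using assms(4) by (simp add: r_def assms(5) power_mult_distrib)
    also have "real N ^ 2 / real N powr \<alpha> = real N powr (2 - \<alpha>)"
      using that by (simp add: powr_diff powr_numeral)
    finally show ?thesis .
  qed
  moreover have "summable (\<lambda>N. 16 * c * real N powr (2 - \<alpha>))"
    using \<alpha> by (intro summable_mult) (simp add: summable_real_powr_iff)
  ultimately have sum: "summable (\<lambda>N. (real N * r N)\<^sup>2)"
    by (subst summable_cong[where g = "\<lambda>N. 16 * c * real N powr (2 - \<alpha>)"])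
       (auto intro: eventually_mono[OF eventually_gt_at_top[of 0]])
  have "0 \<le> r N" for N
    using assms(4) by (simp add: r_def assms(5))
  from AE_eventually_far[OF this sum] AE_space
  show "AE \<omega> in M. \<forall>\<^sub>F N in sequentially. edges (cap_graph (\<lambda>i. X i \<omega>) (a N) N) = {}"
  proof eventually_elim
    case (elim \<omega>)
    show ?case
      using elim(1) assms(7)
    proof eventually_elim
      case (elim N)
      have "0 \<le> sin (a N / 2)"
        using elim by (intro sin_ge_zero) auto
      then have "r N = 4 * sin (a N / 2)"
        using elim by (simp add: r_def)
      moreover have "(\<lambda>i. X i \<omega>) ` {1..N} \<subseteq> S2"
        using X_sphere \<open>\<omega> \<in> space M\<close> by (intro image_subsetI) simp
      ultimately show ?case
        using elim by (intro edges_empty) auto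
    qed
  qed
qed

end
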